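(* Let $\mathbb{F}$ be a field with $|\mathbb{F}|>2$ and let $m\ge 5$ be an integer. Then there is a full-rank aperiodic projective tiling $(U,V)$ of $\mathbb{F}^{2m}$ with $|U|=|V|=|\mathbb{F}|^m$.
   Context: A pair $(U,V)$ of subsets of a vector space $\mathbb{S}$ is a tiling if every element of $\mathbb{S}$ is uniquely represented as $u+v$ with $u\in U$, $v\in V$. A subset $X$ is projective if $\mathbb{F}\cdot X=X$ (a union of $1$-dimensional subspaces); the tiling is projective if both $U$ and $V$ are projective. A subset is full-rank if its affine span is the whole space; a tiling is full-rank if both $U$ and $V$ are full-rank. A period of a set $X$ is a vector $w$ with $X+w=X$; $X$ is aperiodic if its only period is $0$; a tiling is aperiodic if both $U$ and $V$ are aperiodic. *)

theory Defs
  imports "HOL-Analysis.Finite_Cartesian_Product" "HOL-Analysis.Cartesian_Space"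
    "HOL-Library.Equipollence" "HOL-Library.FuncSet"
begin

definition tiling :: "'s::ab_group_add set \<Rightarrow> 's set \<Rightarrow> bool" where
  "tiling U V \<longleftrightarrow> (\<forall>s. \<exists>!p. p \<in> U \<times> V \<and> s = fst p + snd p)"

definition projective :: "('a::field ^ 'n) set \<Rightarrow> bool" where
  "projective X \<longleftrightarrow> {c *s x | c x. x \<in> X} = X"

text \<open>The constant \<open>affine hull\<close> of the library is restricted to real vector spaces.\<close>

definition affine_span :: "('a::field ^ 'n) set \<Rightarrow> ('a ^ 'n) set" where
  "affine_span X = {\<Sum>x\<in>T. c x *s x | T c. finite T \<and> T \<subseteq> X \<and> sum c T = 1}"

definition full_rank :: "('a::field ^ 'n) set \<Rightarrow> bool" where
  "full_rank X \<longleftrightarrow> affine_span X = UNIV"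

definition period :: "'s::ab_group_add set \<Rightarrow> 's \<Rightarrow> bool" where
  "period X w \<longleftrightarrow> (\<lambda>x. x + w) ` X = X"

definition aperiodic :: "'s::ab_group_add set \<Rightarrow> bool" where
  "aperiodic X \<longleftrightarrow> (\<forall>w. period X w \<longrightarrow> w = 0)"

definition projective_tiling :: "('a::field ^ 'n) set \<Rightarrow> ('a ^ 'n) set \<Rightarrow> bool" where
  "projective_tiling U V \<longleftrightarrow> tiling U V \<and> projective U \<and> projective V"

definition full_rank_tiling :: "('a::field ^ 'n) set \<Rightarrow> ('a ^ 'n) set \<Rightarrow> bool" where
  "full_rank_tiling U V \<longleftrightarrow> tiling U V \<and> full_rank U \<and> full_rank V"

definition aperiodic_tiling :: "'s::ab_group_add set \<Rightarrow> 's set \<Rightarrow> bool" where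
  "aperiodic_tiling U V \<longleftrightarrow> tiling U V \<and> aperiodic U \<and> aperiodic V"

end

theory Submission
  imports Defs
begin

text \<open>
  Split the coordinates of $F^{2m}$ into two families \<open>x\<^sub>i\<close> and \<open>y\<^sub>i\<close>, both indexed by the
  integers modulo \<open>m\<close>, and take for \<open>U\<close> the graph \<open>y = f x\<close> and for \<open>V\<close> the graph \<open>x = g y\<close>
  of two homogeneous non-linear maps. The map \<open>f\<close> is local: \<open>f\<^sub>j\<close> is \<open>x\<^sub>j\<close> if \<open>x\<^sub>j\<^sub>-\<^sub>1 \<noteq> 0\<close> and \<open>0\<close>
  otherwise, so changing only \<open>x\<^sub>i\<close> affects only the components \<open>i\<close> and \<open>i + 1\<close> of \<open>f x\<close>.
  The map \<open>g\<close> has at most one non-zero component: \<open>g\<^sub>i\<close> is \<open>y\<^sub>i\<^sub>-\<^sub>1\<close> if \<open>y\<^sub>i\<^sub>-\<^sub>2\<close> and \<open>y\<^sub>i\<^sub>-\<^sub>1\<close> are non-zero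
  and all \<open>y\<^sub>j\<close> with \<open>j\<close> different from \<open>i - 2\<close>, \<open>i - 1\<close>, \<open>i\<close>, \<open>i + 1\<close> vanish, and \<open>0\<close> otherwise;
  for \<open>m \<ge> 5\<close> these conditions exclude one another. Since \<open>g\<^sub>i\<close> ignores \<open>y\<^sub>i\<close> and \<open>y\<^sub>i\<^sub>+\<^sub>1\<close>, moving \<open>x\<close> by a
  multiple of \<open>g y\<close> changes \<open>y = b - f x\<close> without changing \<open>g y\<close>. Hence the system \<open>x + g y = a\<close>,
  \<open>y + f x = b\<close> has the unique solution with \<open>g y = g (b - f a)\<close>.
\<close>

lemma full_rank_if_span:
  fixes X :: "('a::field ^ 'n::finite) set"
  assumes "0 \<in> X" and "vec.span X = UNIV"
  shows "full_rank X"
proof -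
  have "z \<in> affine_span X" for z
  proof -
    have "z \<in> vec.span X" using assms(2) by simp
    then obtain T c where T: "finite T" "T \<subseteq> X" "z = (\<Sum>x\<in>T. c x *s x)"
      unfolding vec.span_explicit by blast
    \<comment> \<open>The vector 0 lies in \<open>X\<close> and adds nothing to the sum, so its
      coefficient can absorb the defect of the coefficient sum from 1.\<close>
    define c' where "c' = c(0 := 1 - sum c (T - {0}))"
    let ?T = "insert 0 (T - {0})"
    have "(\<Sum>x\<in>?T. c' x *s x) = (\<Sum>x\<in>T - {0}. c' x *s x)"
      using T(1) by (subst sum.insert) auto
    also have "\<dots> = (\<Sum>x\<in>T - {0}. c x *s x)"
      by (rule sum.cong) (auto simp: c'_def)
    also have "\<dots> = z"
      unfolding T(3) by (rule sum.mono_neutral_left) (use T(1) in auto)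
    finally have z: "z = (\<Sum>x\<in>?T. c' x *s x)" by simp
    have "sum c' (T - {0}) = sum c (T - {0})"
      by (rule sum.cong) (auto simp: c'_def)
    hence "sum c' ?T = 1"
      using T(1) by (subst sum.insert) (auto simp: c'_def)
    thus ?thesis
      unfolding affine_span_def using z T(1,2) assms(1)
      by (intro CollectI exI[of _ ?T] exI[of _ c']) auto
  qed
  thus ?thesis unfolding full_rank_def by auto
qed

lemma projectiveI:
  fixes X :: "('a::field ^ 'n::finite) set"
  assumes "\<And>c x. x \<in> X \<Longrightarrow> c *s x \<in> X"
  shows "projective X"
proof -
  have "x \<in> {c *s x | c x. x \<in> X}" if "x \<in> X" for x
    using that by (intro CollectI exI[of _ 1] exI[of _ x]) simp
  thus ?thesis unfolding projective_def using assms by blast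
qed

lemma periodD:
  assumes "period X w" "0 \<in> X"
  shows "w \<in> X" "\<And>x. x \<in> X \<Longrightarrow> x + w \<in> X"
  using assms unfolding period_def by force+

section \<open>Cyclic coordinates and the two graphs\<close>

definition gate :: "'a::zero \<Rightarrow> 'a \<Rightarrow> 'a" where
  "gate s t = (if t = 0 then 0 else s)"

lemma gate_scale: "gate (c * s) (c * t) = c * gate s (t :: 'a::field)"
  by (simp add: gate_def)

lemma mod_add_neq_self:
  fixes i d m :: int
  assumes "0 < d" "d < m"
  shows "(i + d) mod m \<noteq> i mod m"
  using assms zdvd_imp_le[of m d] by (auto simp: mod_eq_dvd_iff)

text \<open>Indices run over all integers and coincide modulo \<open>m\<close>, so neighbours such
  as \<open>i - 1\<close> or \<open>i + d\<close> need no reduction; a family over the residues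
  becomes a \<open>cyclic\<close> function on the integers.\<close>

locale paired_cyclic_coordinates =
  fixes p q :: "int \<Rightarrow> 'n::finite" and m :: int
  assumes m_ge: "m \<ge> 5"
    and p_eq_iff: "p i = p j \<longleftrightarrow> i mod m = j mod m"
    and q_eq_iff: "q i = q j \<longleftrightarrow> i mod m = j mod m"
    and p_neq_q: "p i \<noteq> q j"
    and cover: "(\<exists>i. k = p i) \<or> (\<exists>i. k = q i)"
begin

definition cyclic :: "(int \<Rightarrow> 'a) \<Rightarrow> bool" where
  "cyclic x \<longleftrightarrow> (\<forall>i j. i mod m = j mod m \<longrightarrow> x i = x j)"

definition selects :: "(int \<Rightarrow> 'a::zero) \<Rightarrow> int \<Rightarrow> bool" where
  "selects y i \<longleftrightarrow> y (i - 2) \<noteq> 0 \<and> y (i - 1) \<noteq> 0 \<and> (\<forall>d\<in>{2..m - 3}. y (i + d) = 0)"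

definition shift :: "(int \<Rightarrow> 'a::zero) \<Rightarrow> int \<Rightarrow> 'a" where
  "shift y i = (if selects y i then y (i - 1) else 0)"

definition gate_graph :: "('a::field ^ 'n) set" where
  "gate_graph = {z. \<forall>j. z $ q j = gate (z $ p j) (z $ p (j - 1))}"

definition shift_graph :: "('a::field ^ 'n) set" where
  "shift_graph = {z. \<forall>i. z $ p i = shift (\<lambda>j. z $ q j) i}"

lemma cyclicD: "cyclic x \<Longrightarrow> i mod m = j mod m \<Longrightarrow> x i = x j"
  unfolding cyclic_def by blast

lemma cyclic_add_period: "cyclic x \<Longrightarrow> x (i + m) = x i"
  by (erule cyclicD) simp

lemma cyclic_p: "cyclic (\<lambda>i. z $ p i)"
  by (simp add: cyclic_def flip: p_eq_iff)

lemma cyclic_q: "cyclic (\<lambda>i. z $ q i)"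
  by (simp add: cyclic_def flip: q_eq_iff)

lemma cyclicI: "(\<And>i j. i mod m = j mod m \<Longrightarrow> x i = x j) \<Longrightarrow> cyclic x"
  unfolding cyclic_def by blast

lemma cyclic_translate:
  assumes "cyclic x" shows "cyclic (\<lambda>i. x (i + c))"
  by (rule cyclicI) (rule cyclicD[OF assms], rule mod_add_cong, assumption, rule refl)

lemma cyclic_gate:
  assumes "cyclic x" shows "cyclic (\<lambda>i. gate (x i) (x (i - 1)))"
proof (rule cyclicI)
  fix i j assume ij: "i mod m = j mod m"
  show "gate (x i) (x (i - 1)) = gate (x j) (x (j - 1))"
    using cyclicD[OF assms ij] cyclicD[OF cyclic_translate[OF assms] ij, of "-1"] by simp
qed

lemma cyclic_diff:
  assumes "cyclic x" "cyclic y" shows "cyclic (\<lambda>i. x i - y i :: 'a::group_add)"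
proof (rule cyclicI)
  fix i j assume ij: "i mod m = j mod m"
  show "x i - y i = x j - y j"
    using cyclicD[OF assms(1) ij] cyclicD[OF assms(2) ij] by simp
qed

section \<open>Uniqueness and stability of the selected index\<close>

lemma selects_cong:
  assumes "cyclic y" "i mod m = j mod m"
  shows "selects y i \<longleftrightarrow> selects y j"
proof -
  have "y (i + c) = y (j + c)" for c
    using cyclicD[OF cyclic_translate[OF assms(1)] assms(2)] .
  thus ?thesis by (simp only: selects_def diff_conv_add_uminus)
qed

lemma cyclic_shift:
  assumes "cyclic y" shows "cyclic (shift y)"
proof (rule cyclicI)
  fix i j assume "i mod m = j mod m"
  thus "shift y i = shift y j"
    using cyclicD[OF cyclic_translate[OF assms, of "-1"], of i j] selects_cong[OF assms, of i j]
    by (simp add: shift_def)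
qed

text \<open>Let \<open>d\<close> be the cyclic distance from \<open>i\<close> to \<open>k\<close>.
  An entry that one selection needs to be non-zero always falls into the range where the other needs
  zeros; the four cases locate it. At the extreme distances it is the end \<open>m - 3\<close> of
  that range, which is non-empty as \<open>m \<ge> 5\<close>.\<close>

lemma selects_unique:
  fixes y :: "int \<Rightarrow> 'a::zero"
  assumes y: "cyclic y" and i: "selects y i" and k: "selects y k"
  shows "i mod m = k mod m"
proof (rule ccontr)
  assume neq: "i mod m \<noteq> k mod m"
  define d where "d = (k - i) mod m"
  have kd: "k mod m = (i + d) mod m" unfolding d_def by (simp add: mod_simps)
  have d: "0 < d" "d < m"
    using m_ge kd neq pos_mod_sign[of m "k - i"] pos_mod_bound[of m "k - i"]
    by (auto simp: d_def less_le)
  have k': "selects y (i + d)" using k selects_cong[OF y kd] by simp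
  have nz: "y (i - 2) \<noteq> 0" "y (i - 1) \<noteq> 0" "y (i + d - 2) \<noteq> 0" "y (i + d - 1) \<noteq> 0"
    using i k' unfolding selects_def by auto
  have z: "y (i + e) = 0" "y (i + d + e) = 0" if "2 \<le> e" "e \<le> m - 3" for e
    using i k' that unfolding selects_def by auto
  consider "d = 1" | "2 \<le> d" "d \<le> m - 3" | "d = m - 2" | "d = m - 1"
    using d by linarith
  thus False
  proof cases
    case 1
    have "y (i - 2) = y (i + d + (m - 3))"
      using cyclic_add_period[OF y, of "i - 2"] 1 by (simp add: algebra_simps)
    thus False using z(2)[of "m - 3"] nz m_ge by simp
  next
    case 2
    have "y (i - 1) = y (i + d + (m - 1 - d))"
      using cyclic_add_period[OF y, of "i - 1"] by (simp add: algebra_simps)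
    thus False using z(2)[of "m - 1 - d"] nz 2 by simp
  next
    case 3
    hence "i + (m - 3) = i + d - 1" by simp
    from z(1)[of "m - 3", unfolded this] nz m_ge show False by simp
  next
    case 4
    hence "i + (m - 3) = i + d - 2" by simp
    from z(1)[of "m - 3", unfolded this] nz m_ge show False by simp
  qed
qed

text \<open>Only \<open>x\<close> at the selected index \<open>k\<close> can move, and the gate at
  \<open>j\<close> reads \<open>x\<close> at \<open>j\<close> and \<open>j - 1\<close> only. So
  \<open>y\<close> moves at most at \<open>k\<close> and \<open>k + 1\<close>, the entries that the
  selection at \<open>k\<close> ignores. This decouples the system for the tiling, both for
  existence and for uniqueness.\<close>

lemma shift_stable:
  fixes x x' y y' :: "int \<Rightarrow> 'a::ab_group_add"
  assumes y: "cyclic y" "cyclic y'"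
    and x: "\<And>i. shift y i = 0 \<Longrightarrow> x' i = x i"
    and yy: "\<And>j. y' j - y j = gate (x j) (x (j - 1)) - gate (x' j) (x' (j - 1))"
  shows "shift y' = shift y"
proof (cases "\<exists>k. selects y k")
  case False
  hence "x' i = x i" for i using x[of i] by (auto simp: shift_def)
  hence "y' j = y j" for j using yy[of j] by simp
  thus ?thesis by presburger
next
  case True
  then obtain k where k: "selects y k" by blast
  have xj: "x' j = x j" if "j mod m \<noteq> k mod m" for j
    using x[of j] selects_unique[OF y(1) _ k, of j] that unfolding shift_def by metis
  have same: "y' (k + d) = y (k + d)" if "2 \<le> d" "d < m" for d
  proof -
    have "(k + d) mod m \<noteq> k mod m" "(k + d - 1) mod m \<noteq> k mod m"
      using mod_add_neq_self[of d m k] mod_add_neq_self[of "d - 1" m k] that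
      by (simp_all add: algebra_simps)
    thus ?thesis using yy[of "k + d"] xj[of "k + d"] xj[of "k + d - 1"] by simp
  qed
  \<comment> \<open>\<open>same\<close> reaches these entries by wrapping around, as
    \<open>m - 1\<close> and \<open>m - 2\<close>, both at least 2.\<close>
  have eq1: "y' (k - 1) = y (k - 1)" and eq2: "y' (k - 2) = y (k - 2)"
    using same[of "m - 1"] same[of "m - 2"] m_ge
      cyclic_add_period[OF y(1), of "k - 1"] cyclic_add_period[OF y(2), of "k - 1"]
      cyclic_add_period[OF y(1), of "k - 2"] cyclic_add_period[OF y(2), of "k - 2"]
    by (simp_all add: algebra_simps)
  have k': "selects y' k"
    using k same eq1 eq2 unfolding selects_def by auto
  show ?thesis
  proof
    fix i
    show "shift y' i = shift y i"
    proof (cases "i mod m = k mod m")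
      case True
      have "shift y' k = shift y k" using k k' eq1 by (simp add: shift_def)
      thus ?thesis
        using cyclicD[OF cyclic_shift[OF y(1)] True] cyclicD[OF cyclic_shift[OF y(2)] True] by simp
    next
      case False
      thus ?thesis
        using selects_unique[OF y(1) _ k] selects_unique[OF y(2) _ k'] by (auto simp: shift_def)
    qed
  qed
qed

section \<open>The tiling\<close>

lemma vec_eqI:
  fixes z w :: "'a ^ 'n"
  assumes "\<And>i. z $ p i = w $ p i" "\<And>i. z $ q i = w $ q i"
  shows "z = w"
  unfolding vec_eq_iff using cover assms by metis

lemma vec_of_cyclic:
  fixes x y :: "int \<Rightarrow> 'a"
  assumes "cyclic x" "cyclic y"
  obtains z :: "'a ^ 'n" where "\<And>i. z $ p i = x i" "\<And>i. z $ q i = y i"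
proof
  \<comment> \<open>Cyclicity makes the index picked by \<open>SOME\<close> irrelevant.\<close>
  define z :: "'a ^ 'n" where
    "z = (\<chi> k. if \<exists>i. k = p i then x (SOME i. k = p i) else y (SOME i. k = q i))"
  fix i
  have "p i = p (SOME j. p i = p j)" "q i = q (SOME j. q i = q j)"
    by (rule someI[of _ i], rule refl)+
  hence "x (SOME j. p i = p j) = x i" "y (SOME j. q i = q j) = y i"
    using assms cyclicD p_eq_iff q_eq_iff by metis+
  moreover have "\<not> (\<exists>j. q i = p j)" using p_neq_q by metis
  ultimately show "z $ p i = x i" "z $ q i = y i" unfolding z_def by auto
qed

lemma gate_graph_point:
  fixes x :: "int \<Rightarrow> 'a::field"
  assumes "cyclic x"
  obtains u where "u \<in> gate_graph" "\<And>i. u $ p i = x i"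
    "\<And>j. u $ q j = gate (x j) (x (j - 1))"
  using vec_of_cyclic[OF assms cyclic_gate[OF assms]] unfolding gate_graph_def by auto

lemma shift_graph_point:
  fixes y :: "int \<Rightarrow> 'a::field"
  assumes "cyclic y"
  obtains v where "v \<in> shift_graph" "\<And>i. v $ p i = shift y i" "\<And>j. v $ q j = y j"
  using vec_of_cyclic[OF cyclic_shift[OF assms] assms] unfolding shift_graph_def by auto

lemma tiling_gate_shift: "tiling (gate_graph :: ('a::field ^ 'n) set) shift_graph"
  unfolding tiling_def
proof
  fix s :: "'a ^ 'n"
  define a where "a i = s $ p i" for i
  define b where "b i = s $ q i" for i
  \<comment> \<open>\<open>y0\<close> uses the known \<open>a\<close> where the equation for
    \<open>y\<close> has the unknown \<open>x\<close>. By \<open>shift_stable\<close> the true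
    \<open>y\<close> has the same \<open>shift\<close>, so this \<open>x\<close> solves the
    system.\<close>
  define y0 where "y0 j = b j - gate (a j) (a (j - 1))" for j
  define x where "x i = a i - shift y0 i" for i
  have cyc: "cyclic a" "cyclic b" unfolding a_def b_def by (rule cyclic_p cyclic_q)+
  have cy0: "cyclic y0" unfolding y0_def by (intro cyclic_diff cyclic_gate cyc)
  have cx: "cyclic x" unfolding x_def by (intro cyclic_diff cyclic_shift cyc cy0)
  obtain u where u: "u \<in> gate_graph" "\<And>i. u $ p i = x i"
    "\<And>j. u $ q j = gate (x j) (x (j - 1))"
    using gate_graph_point[OF cx] by blast
  define y where "y j = b j - gate (x j) (x (j - 1))" for j
  have cy: "cyclic y" unfolding y_def by (intro cyclic_diff cyclic_gate cyc cx)
  have sy: "shift y = shift y0"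
    by (rule shift_stable[OF cy0 cy, of x a]) (auto simp: x_def y_def y0_def)
  obtain v where v: "v \<in> shift_graph" "\<And>i. v $ p i = shift y i" "\<And>j. v $ q j = y j"
    using shift_graph_point[OF cy] by blast
  have s: "s = u + v"
    by (rule vec_eqI) (simp_all add: u v sy x_def y_def a_def b_def)
  \<comment> \<open>The first summand is enough, since the second is then
    \<open>s - u\<close>.\<close>
  have unique: "u' = u" if "u' \<in> gate_graph" "v' \<in> shift_graph" "s = u' + v'" for u' v'
  proof -
    define x' where "x' i = u' $ p i" for i
    define y' where "y' i = v' $ q i" for i
    have u': "u' $ q j = gate (x' j) (x' (j - 1))" for j
      using that(1) by (simp add: gate_graph_def x'_def)
    have v': "v' $ p i = shift y' i" for i
      using that(2) by (simp add: shift_graph_def y'_def[abs_def])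
    have cy': "cyclic y'" unfolding y'_def by (rule cyclic_q)
    have a: "a i = x' i + shift y' i" and b: "b i = y' i + gate (x' i) (x' (i - 1))" for i
      using u'[of i] v'[of i] by (simp_all add: a_def b_def that(3) x'_def y'_def)
    \<comment> \<open>Now the move goes from an arbitrary solution \<open>x'\<close> to
      \<open>a\<close>, which forces \<open>x'\<close> to be \<open>a\<close> minus
      \<open>shift y0\<close>.\<close>
    have "shift y0 = shift y'"
      by (rule shift_stable[OF cy' cy0, of a x']) (simp_all add: y0_def b a)
    hence x': "x' i = x i" for i using a[of i] by (simp add: x_def)
    show "u' = u"
    proof (rule vec_eqI)
      show "u' $ p i = u $ p i" for i using x'[of i] by (simp add: x'_def u)
      show "u' $ q i = u $ q i" for i by (simp only: u u' x')
    qed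
  qed
  show "\<exists>!w. w \<in> gate_graph \<times> shift_graph \<and> s = fst w + snd w"
  proof (rule ex1I[of _ "(u, v)"])
    show "(u, v) \<in> gate_graph \<times> shift_graph \<and> s = fst (u, v) + snd (u, v)"
      using u(1) v(1) s by simp
  next
    fix w :: "('a ^ 'n) \<times> ('a ^ 'n)"
    assume w: "w \<in> gate_graph \<times> shift_graph \<and> s = fst w + snd w"
    hence "fst w = u" using unique[of "fst w" "snd w"] by auto
    with w s show "w = (u, v)" by (auto simp: prod_eq_iff)
  qed
qed

section \<open>Homogeneity and aperiodicity\<close>

lemma shift_scale: "shift (\<lambda>j. c * y j) i = c * shift y (i::int)" for c :: "'a::field"
  by (cases "c = 0") (simp_all add: shift_def selects_def)

lemma projective_gate_graph: "projective (gate_graph :: ('a::field ^ 'n) set)"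
  by (rule projectiveI) (simp add: gate_graph_def gate_scale)

lemma projective_shift_graph: "projective (shift_graph :: ('a::field ^ 'n) set)"
  by (rule projectiveI) (simp add: shift_graph_def shift_scale)

lemma zero_in_gate_graph: "0 \<in> gate_graph" and zero_in_shift_graph: "0 \<in> shift_graph"
  by (simp_all add: gate_graph_def shift_graph_def gate_def shift_def)

definition bump :: "int \<Rightarrow> int \<Rightarrow> 'a::zero_neq_one" where
  "bump i j = (if j mod m = i mod m then 1 else 0)"

lemma bump_self: "bump i i = 1"
  by (simp add: bump_def)

lemma bump_add: "0 < d \<Longrightarrow> d < m \<Longrightarrow> bump i (i + d) = (0 :: 'a::zero_neq_one)"
  using mod_add_neq_self[of d m i] by (auto simp: bump_def)

lemma bump_diff: "0 < d \<Longrightarrow> d < m \<Longrightarrow> bump i (i - d) = (0 :: 'a::zero_neq_one)"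
  using mod_add_neq_self[of d m "i - d"] by (auto simp: bump_def)

lemma bump_neighbours:
  "bump (i - 2) (i - 1) = (0 :: 'a::zero_neq_one)" "bump (i - 1) (i - 2) = (0 :: 'a)"
  using bump_add[of 1 "i - 2", where 'a='a] bump_diff[of 1 "i - 1", where 'a='a] m_ge
  by (simp_all add: algebra_simps)

lemma cyclic_comb: "cyclic (\<lambda>j. s * bump i j + t * bump k j :: 'a::field)"
  unfolding cyclic_def bump_def by auto

lemma aperiodic_gate_graph: "aperiodic (gate_graph :: ('a::field ^ 'n) set)"
  unfolding aperiodic_def
proof (intro allI impI)
  fix w :: "'a ^ 'n"
  assume w: "period gate_graph w"
  note wU = periodD[OF w zero_in_gate_graph]
  have "w $ p i = 0" for i
  proof (rule ccontr)
    assume nz: "w $ p i \<noteq> 0"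
    \<comment> \<open>Adding \<open>w\<close> to this point turns the entries at \<open>i\<close>
      and \<open>i + 1\<close> into 0 and 1. The gate at \<open>i + 1\<close> is open for both
      summands, so their outputs add up to 1, but it is closed for the sum, which would need output
      0.\<close>
    define x where "x j = - (w $ p i) * bump i j + (1 - w $ p (i + 1)) * bump (i + 1) j" for j
    have cx: "cyclic x" unfolding x_def by (rule cyclic_comb)
    have xi: "x i = - (w $ p i)" "x (i + 1) = 1 - w $ p (i + 1)"
      using bump_add[of 1 i, where 'a='a] bump_diff[of 1 "i + 1", where 'a='a] m_ge
      by (simp_all add: x_def bump_self)
    obtain u where u: "u \<in> gate_graph" "\<And>i. u $ p i = x i"
      "\<And>j. u $ q j = gate (x j) (x (j - 1))"
      using gate_graph_point[OF cx] by blast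
    have "(u + w) $ q (i + 1) = gate ((u + w) $ p (i + 1)) ((u + w) $ p (i + 1 - 1))"
      using wU(2)[OF u(1)] unfolding gate_graph_def by blast
    moreover have "w $ q (i + 1) = gate (w $ p (i + 1)) (w $ p (i + 1 - 1))"
      using wU(1) unfolding gate_graph_def by blast
    ultimately show False using nz by (simp add: u xi gate_def)
  qed
  moreover from this have "w $ q i = 0" for i
    using wU(1) by (simp add: gate_graph_def gate_def)
  ultimately show "w = 0" by (intro vec_eqI) auto
qed

lemma selects_comb:
  assumes "s \<noteq> 0" "t \<noteq> (0::'a::field)"
  shows "selects (\<lambda>j. s * bump (i - 2) j + t * bump (i - 1) j) i"
proof -
  have "bump (i - 2) (i + d) = (0::'a)" "bump (i - 1) (i + d) = (0::'a)" if "d \<in> {2..m - 3}" for d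
    using that bump_add[of "d + 2" "i - 2", where 'a='a] bump_add[of "d + 1" "i - 1", where 'a='a]
    by (simp_all add: algebra_simps)
  thus ?thesis using assms by (simp add: selects_def bump_self bump_neighbours)
qed

text \<open>Two adjacent non-zero entries select the index after them, and
  \<open>selects_unique\<close> excludes all others. Such points witness both aperiodicity and full
  rank.\<close>

lemma shift_comb:
  assumes "s \<noteq> 0" "t \<noteq> (0::'a::field)"
  shows "shift (\<lambda>j. s * bump (i - 2) j + t * bump (i - 1) j) k = t * bump i k"
proof -
  let ?y = "\<lambda>j. s * bump (i - 2) j + t * bump (i - 1) j"
  have sel: "selects ?y i" using selects_comb[OF assms] .
  hence i: "shift ?y i = t" by (simp add: shift_def bump_self bump_neighbours)
  show ?thesis
  proof (cases "k mod m = i mod m")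
    case True
    hence "shift ?y k = shift ?y i" by (rule cyclicD[OF cyclic_shift[OF cyclic_comb]])
    moreover have "bump i k = (1::'a)" using True by (simp add: bump_def)
    ultimately show ?thesis using i by simp
  next
    case False
    hence "\<not> selects ?y k" using selects_unique[OF cyclic_comb sel, of k] by auto
    thus ?thesis using False by (simp add: shift_def bump_def)
  qed
qed

lemma shift_bump: "shift (bump i) k = (0 :: 'a::zero_neq_one)"
proof -
  have "\<not> (bump i (k - 2) \<noteq> (0::'a) \<and> bump i (k - 1) \<noteq> (0::'a))"
    using mod_add_neq_self[of 1 m "k - 2"] m_ge by (auto simp: bump_def)
  thus ?thesis by (auto simp: shift_def selects_def)
qed

lemma aperiodic_shift_graph: "aperiodic (shift_graph :: ('a::field ^ 'n) set)"
  unfolding aperiodic_def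
proof (intro allI impI)
  fix w :: "'a ^ 'n"
  assume w: "period shift_graph w"
  note wV = periodD[OF w zero_in_shift_graph]
  have "w $ q (i - 2) = 0" for i
  proof (rule ccontr)
    assume nz: "w $ q (i - 2) \<noteq> 0"
    have "t + w $ p i = 0" for t
    proof -
      \<comment> \<open>Adding \<open>w\<close> cancels the entry at \<open>i - 2\<close> and so
        destroys the selection at \<open>i\<close>, while \<open>v\<close> itself has the free value
        \<open>t\<close> there. The entry of \<open>w\<close> at \<open>p i\<close> would be
        \<open>- t\<close> for every \<open>t\<close>.\<close>
      define y where "y j = - (w $ q (i - 2)) * bump (i - 2) j + t * bump (i - 1) j" for j
      have cy: "cyclic y" unfolding y_def by (rule cyclic_comb)
      have y2: "y (i - 2) = - (w $ q (i - 2))" and y1: "y (i - 1) = t"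
        by (simp_all add: y_def bump_self bump_neighbours)
      have yi: "shift y i = t"
      proof (cases "t = 0")
        case True
        thus ?thesis by (simp add: shift_def y1)
      next
        case False
        thus ?thesis
          unfolding y_def using nz by (subst shift_comb) (auto simp: bump_self)
      qed
      obtain v where v: "v \<in> shift_graph" "\<And>i. v $ p i = shift y i" "\<And>j. v $ q j = y j"
        using shift_graph_point[OF cy] by blast
      have "(v + w) $ p i = shift (\<lambda>j. (v + w) $ q j) i"
        using wV(2)[OF v(1)] unfolding shift_graph_def by blast
      also have "\<dots> = 0" by (simp add: shift_def selects_def v y2)
      finally show ?thesis by (simp add: v yi)
    qed
    from this[of 0] this[of 1] show False by simp
  qed
  hence "w $ q i = 0" for i by (metis add_diff_cancel_right')
  moreover from this have "w $ p i = 0" for i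
    using wV(1) by (simp add: shift_graph_def shift_def selects_def)
  ultimately show "w = 0" by (intro vec_eqI) auto
qed

section \<open>Full rank\<close>

lemma span_eq_UNIV:
  fixes X :: "('a::field ^ 'n) set"
  assumes "\<And>i. axis (p i) 1 \<in> vec.span X" "\<And>i. axis (q i) 1 \<in> vec.span X"
  shows "vec.span X = UNIV"
proof -
  have "axis k 1 \<in> vec.span X" for k using cover[of k] assms by auto
  hence "cart_basis \<subseteq> vec.span X" by (auto simp: cart_basis_def)
  hence "vec.span cart_basis \<subseteq> vec.span X" by (intro vec.span_minimal vec.subspace_span)
  thus ?thesis by (simp add: top.extremum_unique)
qed

lemma axis_nth:
  "axis (p i) 1 $ p j = (bump i j :: 'a::field)" "axis (p i) 1 $ q j = (0 :: 'a)"
  "axis (q i) 1 $ q j = (bump i j :: 'a)" "axis (q i) 1 $ p j = (0 :: 'a)"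
  using p_neq_q by (auto simp: axis_def p_eq_iff q_eq_iff bump_def) metis

text \<open>A single unit entry opens no gate with non-zero input, so every
  \<open>axis (p i) 1\<close> lies in the graph. Two adjacent unit entries open the gate at
  \<open>i\<close>; subtracting them leaves \<open>axis (q i) 1\<close>.\<close>

lemma full_rank_gate_graph: "full_rank (gate_graph :: ('a::field ^ 'n) set)"
proof (rule full_rank_if_span[OF zero_in_gate_graph span_eq_UNIV])
  have consecutive: "j mod m \<noteq> i mod m" if "(j - 1) mod m = i mod m" for i j
    using mod_add_neq_self[of 1 m "j - 1"] m_ge that by auto
  have "axis (p i) 1 \<in> (gate_graph :: ('a ^ 'n) set)" for i
    using consecutive by (auto simp: gate_graph_def axis_nth gate_def bump_def)
  thus P: "axis (p i) 1 \<in> vec.span (gate_graph :: ('a ^ 'n) set)" for i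
    by (rule vec.span_base)
  fix i
  let ?u = "axis (p (i - 1)) 1 + axis (p i) 1 + axis (q i) 1 :: 'a ^ 'n"
  \<comment> \<open>At \<open>i\<close> the input and the control are both 1; at
    \<open>i - 1\<close> the control sits at \<open>i - 2\<close>, outside the support; elsewhere
    the input is 0.\<close>
  have "bump i j = gate (bump (i - 1) j + bump i j) (bump (i - 1) (j - 1) + bump i (j - 1) :: 'a)"
    for j
  proof -
    consider "j mod m = i mod m" | "j mod m = (i - 1) mod m"
      | "j mod m \<noteq> i mod m" "j mod m \<noteq> (i - 1) mod m" by blast
    thus ?thesis
    proof cases
      case 1
      hence "(j - 1) mod m = (i - 1) mod m" by (metis mod_diff_left_eq)
      with 1 show ?thesis
        using consecutive[of i "i - 1"] consecutive[of j i] by (auto simp: bump_def gate_def)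
    next
      case 2
      hence j: "(j - 1) mod m = (i - 2) mod m"
        using mod_diff_left_eq[of j m 1] mod_diff_left_eq[of "i - 1" m 1] by simp
      have "(i - 2) mod m \<noteq> i mod m" "(i - 2) mod m \<noteq> (i - 1) mod m" "(i - 1) mod m \<noteq> i mod m"
        using mod_add_neq_self[of 2 m "i - 2"] mod_add_neq_self[of 1 m "i - 2"]
          mod_add_neq_self[of 1 m "i - 1"] m_ge by auto
      with 2 j show ?thesis by (auto simp: bump_def gate_def)
    next
      case 3
      thus ?thesis by (simp add: bump_def gate_def)
    qed
  qed
  hence "?u \<in> gate_graph" by (simp add: gate_graph_def axis_nth)
  hence "?u - axis (p (i - 1)) 1 - axis (p i) 1 \<in> vec.span gate_graph"
    by (intro vec.span_diff P vec.span_base)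
  thus "axis (q i) 1 \<in> vec.span (gate_graph :: ('a ^ 'n) set)" by simp
qed

text \<open>A lone entry selects nothing, which gives the vectors \<open>axis (q i) 1\<close>; an
  adjacent pair selects \<open>i\<close>, and subtracting the pair leaves
  \<open>axis (p i) 1\<close>.\<close>

lemma full_rank_shift_graph: "full_rank (shift_graph :: ('a::field ^ 'n) set)"
proof (rule full_rank_if_span[OF zero_in_shift_graph span_eq_UNIV])
  show Q: "axis (q i) 1 \<in> vec.span (shift_graph :: ('a ^ 'n) set)" for i
    by (rule vec.span_base) (simp add: shift_graph_def axis_nth shift_bump)
  fix i
  let ?v = "axis (q (i - 2)) 1 + axis (q (i - 1)) 1 + axis (p i) 1 :: 'a ^ 'n"
  have "?v \<in> shift_graph"
    using shift_comb[of "1::'a" "1::'a" i] by (simp add: shift_graph_def axis_nth)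
  hence "?v - axis (q (i - 2)) 1 - axis (q (i - 1)) 1 \<in> vec.span shift_graph"
    by (intro vec.span_diff Q vec.span_base)
  thus "axis (p i) 1 \<in> vec.span (shift_graph :: ('a ^ 'n) set)" by simp
qed

section \<open>Cardinality\<close>

lemma eqpoll_functions:
  fixes X :: "('a ^ 'n) set" and r :: "int \<Rightarrow> 'n"
  assumes cyc: "\<And>z :: 'a ^ 'n. cyclic (\<lambda>i. z $ r i)"
    and ex: "\<And>x :: int \<Rightarrow> 'a. cyclic x \<Longrightarrow> \<exists>z\<in>X. \<forall>i. z $ r i = x i"
    and inj: "\<And>z w. z \<in> X \<Longrightarrow> w \<in> X \<Longrightarrow> (\<And>i. z $ r i = w $ r i) \<Longrightarrow> z = w"
  shows "X \<approx> ({..<nat m} \<rightarrow>\<^sub>E (UNIV :: 'a set))"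
proof -
  \<comment> \<open>A cyclic function is the same as its restriction to one full set of residues, so
    this is a bijection also over an infinite field.\<close>
  let ?h = "\<lambda>z :: 'a ^ 'n. \<lambda>a\<in>{..<nat m}. z $ r (int a)"
  have m: "nat (i mod m) < nat m" "int (nat (i mod m)) mod m = i mod m" for i
    using m_ge by simp_all
  have "inj_on ?h X"
  proof (rule inj_onI)
    fix z w assume zw: "z \<in> X" "w \<in> X" "?h z = ?h w"
    have "z $ r i = w $ r i" for i
    proof -
      have "z $ r (int (nat (i mod m))) = w $ r (int (nat (i mod m)))"
        using fun_cong[OF zw(3), of "nat (i mod m)"] m(1)[of i] by simp
      thus ?thesis using cyclicD[OF cyc m(2)] by metis
    qed
    thus "z = w" using inj zw by blast
  qed
  moreover have "?h ` X = {..<nat m} \<rightarrow>\<^sub>E UNIV"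
  proof (intro equalityI subsetI)
    fix f assume f: "f \<in> {..<nat m} \<rightarrow>\<^sub>E (UNIV :: 'a set)"
    have "cyclic (\<lambda>i. f (nat (i mod m)))" by (simp add: cyclic_def)
    from ex[OF this] obtain z where z: "z \<in> X" "\<And>i. z $ r i = f (nat (i mod m))" by blast
    have "?h z = f"
    proof
      fix a show "?h z a = f a" using f by (cases "a < nat m") (auto simp: z PiE_def extensional_def)
    qed
    thus "f \<in> ?h ` X" using z(1) by blast
  qed (auto split: if_splits)
  ultimately show ?thesis unfolding eqpoll_def bij_betw_def by blast
qed

lemma gate_graph_eqpoll:
  "(gate_graph :: ('a::field ^ 'n) set) \<approx> ({..<nat m} \<rightarrow>\<^sub>E (UNIV :: 'a set))"
proof (rule eqpoll_functions[OF cyclic_p])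
  show "\<exists>z\<in>gate_graph. \<forall>i. z $ p i = x i" if "cyclic x" for x :: "int \<Rightarrow> 'a"
    using gate_graph_point[OF that] by metis
  show "z = w" if "z \<in> gate_graph" "w \<in> gate_graph" "\<And>i. z $ p i = w $ p i" for z w :: "'a ^ 'n"
    using that by (intro vec_eqI) (simp_all add: gate_graph_def)
qed

lemma shift_graph_eqpoll:
  "(shift_graph :: ('a::field ^ 'n) set) \<approx> ({..<nat m} \<rightarrow>\<^sub>E (UNIV :: 'a set))"
proof (rule eqpoll_functions[OF cyclic_q])
  show "\<exists>z\<in>shift_graph. \<forall>i. z $ q i = y i" if "cyclic y" for y :: "int \<Rightarrow> 'a"
    using shift_graph_point[OF that] by metis
  show "z = w" if "z \<in> shift_graph" "w \<in> shift_graph" "\<And>i. z $ q i = w $ q i" for z w :: "'a ^ 'n"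
    using that by (intro vec_eqI) (simp_all add: shift_graph_def)
qed

end

section \<open>Existence of the coordinates and conclusion\<close>

lemma ex_paired_cyclic_coordinates:
  fixes m :: nat
  assumes "m \<ge> 5" "CARD('n::finite) = 2 * m"
  obtains p q :: "int \<Rightarrow> 'n::finite" where "paired_cyclic_coordinates p q (int m)"
proof -
  obtain h where h: "bij_betw h {0..<2 * m} (UNIV :: 'n set)"
    using ex_bij_betw_nat_finite[of "UNIV :: 'n set"] assms(2) by auto
  hence inj: "h a = h b \<longleftrightarrow> a = b" if "a < 2 * m" "b < 2 * m" for a b
    using that by (intro inj_on_eq_iff[OF bij_betw_imp_inj_on]) auto
  \<comment> \<open>With \<open>r\<close> reducing modulo \<open>m\<close>, the first half of the
    enumeration \<open>h\<close> serves as \<open>p\<close> and the second half as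
    \<open>q\<close>.\<close>
  define r where "r i = nat (i mod int m)" for i
  have r: "r i < m" for i using assms(1) by (simp add: r_def nat_less_iff)
  have r_eq: "r i = r j \<longleftrightarrow> i mod int m = j mod int m" for i j
    using assms(1) by (simp add: r_def eq_nat_nat_iff)
  have r_int: "r (int a) = a" if "a < m" for a using that by (simp add: r_def)
  show ?thesis
  proof (rule that, unfold_locales)
    show "int m \<ge> 5" using assms(1) by simp
    show "h (r i) = h (r j) \<longleftrightarrow> i mod int m = j mod int m" for i j
      using r[of i] r[of j] inj r_eq by simp
    show "h (m + r i) = h (m + r j) \<longleftrightarrow> i mod int m = j mod int m" for i j
      using r[of i] r[of j] inj r_eq by simp
    show "h (r i) \<noteq> h (m + r j)" for i j
      using r[of i] r[of j] inj by simp
    fix k :: 'n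
    obtain a where a: "k = h a" "a < 2 * m" using bij_betw_imp_surj_on[OF h] by (metis UNIV_I atLeastLessThan_iff imageE)
    show "(\<exists>i. k = h (r i)) \<or> (\<exists>i. k = h (m + r i))"
    proof (cases "a < m")
      case True
      thus ?thesis using a r_int[of a] by metis
    next
      case False
      hence "h (m + r (int (a - m))) = k" using a r_int[of "a - m"] by simp
      thus ?thesis by metis
    qed
  qed
qed

theorem theorem2:
  fixes m :: nat
  assumes "{..<2::nat} \<prec> (UNIV :: 'a::field set)"
    and "m \<ge> 5"
    and "CARD('n::finite) = 2 * m"
  shows "\<exists>U V :: ('a ^ 'n) set.
    full_rank_tiling U V \<and> aperiodic_tiling U V \<and> projective_tiling U V \<and>
    U \<approx> ({..<m} \<rightarrow>\<^sub>E (UNIV :: 'a set)) \<and>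
    V \<approx> ({..<m} \<rightarrow>\<^sub>E (UNIV :: 'a set))"
proof -
  obtain p q :: "int \<Rightarrow> 'n" where "paired_cyclic_coordinates p q (int m)"
    using ex_paired_cyclic_coordinates[OF assms(2,3)] by blast
  then interpret paired_cyclic_coordinates p q "int m" .
  show ?thesis
    unfolding full_rank_tiling_def aperiodic_tiling_def projective_tiling_def
    using tiling_gate_shift full_rank_gate_graph full_rank_shift_graph aperiodic_gate_graph
      aperiodic_shift_graph projective_gate_graph projective_shift_graph
      gate_graph_eqpoll[where 'a='a] shift_graph_eqpoll[where 'a='a]
    by (intro exI[of _ gate_graph] exI[of _ shift_graph]) simp
qed

end
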